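(* Let $\rho>0$ and let $\Phi:B_{\rho}\to H$ be a $C^1$ function whose derivative is Lipschitzian with constant $\gamma$. Set $$\theta:=\sup_{x\in B_{\rho}}\|\Phi'(x)\|_{\mathcal{L}(H)},\qquad M:=2(\theta+\rho\gamma)$$ and assume also that $$\sigma:=\inf_{y\in B_{\rho}}\sup_{\|u\|=1}|\langle\Phi(0),u\rangle-\langle\Phi'(0)(u),y\rangle|>0.$$ Then, for each $r\in\left]0,\min\left\{\rho,\frac{\sigma}{2M}\right\}\right]$, there exists a unique $x^*\in S_r$ such that $$\max\{\langle\Phi(x^* ),x^*-x\rangle,\langle\Phi(x),x^*-x\rangle\}<0$$ for all $x\in B_r\setminus\{x^*\}$.
   Context: $(H,\langle\cdot,\cdot\rangle)$ is a real Hilbert space. For each $r>0$, $B_r=\{x\in H:\|x\|\leq r\}$ and $S_r=\{x\in H:\|x\|=r\}$. $\mathcal{L}(H)$ is the space of bounded linear operators from $H$ to $H$ with the operator norm $\|\cdot\|_{\mathcal{L}(H)}$, and $\Phi'(x)\in\mathcal{L}(H)$ is the Fréchet derivative of $\Phi$ at $x$. $]a,b]$ denotes the half-open interval $\{t: a<t\leq b\}$. The Lipschitz constant $\gamma$ is taken to be positive, so that $\sigma/(2M)$ is defined. *)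

theory Defs
  imports "HOL-Analysis.Analysis"
begin

end

theory Submission
  imports Defs
begin

text \<open>
  Testing the infimum that defines \<open>\<sigma>\<close> at \<open>y = 0\<close> gives \<open>\<sigma> \<le> norm (\<Phi> 0)\<close>, and the mean
  value inequality makes \<open>\<Phi>\<close> \<open>\<theta>\<close>-Lipschitz. The bound on \<open>r\<close> therefore yields
  \<open>3 * \<theta> * r < norm (\<Phi> 0)\<close>: on the ball of radius \<open>r\<close> the map \<open>\<Phi>\<close> varies little compared
  with its size, and that is all that the argument needs.

  Under this condition \<open>x \<mapsto> - r *\<^sub>R sgn (\<Phi> x)\<close> is a contraction of the ball
  (\<open>sphere_point_opposite_field\<close>). Its fixed point \<open>p\<close> satisfies \<open>norm p = r\<close> and
  \<open>\<Phi> p = - c *\<^sub>R p\<close> with \<open>c > 2 * \<theta>\<close>. On the ball, \<open>p \<bullet> (p - x) \<ge> (norm (x - p))\<^sup>2 / 2\<close>, so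
  \<open>\<Phi> p \<bullet> (p - x) \<le> - (c / 2) * (norm (x - p))\<^sup>2\<close>. Passing from \<open>\<Phi> p\<close> to \<open>\<Phi> x\<close> costs
  at most \<open>\<theta> * (norm (x - p))\<^sup>2\<close>, which is smaller; hence both inner products are negative
  for \<open>x \<noteq> p\<close>. Uniqueness is immediate: for two such points \<open>p\<close> and \<open>q\<close>, both
  \<open>\<Phi> p \<bullet> (p - q)\<close> and \<open>\<Phi> p \<bullet> (q - p)\<close> would be negative.
\<close>

lemma norm_mult_norm_sgn_diff_le:
  fixes a b :: "'a::real_normed_vector"
  shows "norm a * norm (sgn a - sgn b) \<le> 2 * norm (a - b)"
proof -
  have sgn: "norm v *\<^sub>R sgn v = v" for v :: 'a
    by (cases "v = 0") (simp_all add: sgn_div_norm)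
  have "norm a *\<^sub>R (sgn a - sgn b) = (a - b) + (norm b - norm a) *\<^sub>R sgn b"
    by (simp add: scaleR_diff_right scaleR_diff_left sgn)
  then have "norm a * norm (sgn a - sgn b) = norm ((a - b) + (norm b - norm a) *\<^sub>R sgn b)"
    by (metis abs_norm_cancel norm_scaleR)
  also have "\<dots> \<le> norm (a - b) + \<bar>norm b - norm a\<bar> * norm (sgn b)"
    by (metis norm_scaleR norm_triangle_ineq)
  also have "\<bar>norm b - norm a\<bar> * norm (sgn b) \<le> \<bar>norm b - norm a\<bar>"
    by (simp add: norm_sgn)
  also have "\<bar>norm b - norm a\<bar> \<le> norm (a - b)"
    by (metis norm_minus_commute norm_triangle_ineq3)
  finally show ?thesis by simp
qed

text \<open>
  The Euclidean ball is uniformly convex: at a boundary point, the supporting functional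
  leaves a gap that is quadratic in the distance to that point. This gap absorbs the
  Lipschitz variation of \<open>\<Phi>\<close> in \<open>ex1_strict_variational_solution\<close>.
\<close>

lemma inner_diff_ge_on_cball:
  fixes p x :: "'a::real_inner"
  assumes "norm x \<le> norm p"
  shows "(norm (x - p))\<^sup>2 / 2 \<le> p \<bullet> (p - x)"
proof -
  have "(norm x)\<^sup>2 \<le> (norm p)\<^sup>2"
    using assms by (simp add: power_mono)
  then show ?thesis
    by (simp add: power2_norm_eq_inner inner_diff_left inner_diff_right inner_commute)
qed

text \<open>
  On the ball \<open>norm (\<Phi> x)\<close> is at least \<open>m = norm (\<Phi> 0) - L * r > 2 * L * r\<close>. Normalising
  a vector of norm at least \<open>m\<close> is Lipschitz with constant \<open>2 / m\<close>, so
  \<open>x \<mapsto> - r *\<^sub>R sgn (\<Phi> x)\<close> is a contraction.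
\<close>

lemma sphere_point_opposite_field:
  fixes \<Phi> :: "'a::{real_normed_vector, complete_space} \<Rightarrow> 'a"
  assumes lip: "L-lipschitz_on (cball 0 r) \<Phi>" and "0 < r"
    and small: "3 * L * r < norm (\<Phi> 0)"
  obtains p c where "norm p = r" "\<Phi> p = - c *\<^sub>R p" "2 * L < c"
proof -
  have "0 \<le> L" using lip by (rule lipschitz_on_nonneg)
  define m where "m = norm (\<Phi> 0) - L * r"
  have m: "2 * L * r < m" using small by (simp add: m_def)
  then have "0 < m"
    using \<open>0 \<le> L\<close> \<open>0 < r\<close> by (smt (verit) mult_nonneg_nonneg)
  have lower: "m \<le> norm (\<Phi> x)" if "x \<in> cball 0 r" for x
  proof -
    have "norm (\<Phi> 0 - \<Phi> x) \<le> L * norm (0 - x)"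
      using lipschitz_onD[OF lip, of 0 x] that \<open>0 < r\<close> by (simp add: dist_norm)
    also have "\<dots> \<le> L * r"
      using that \<open>0 \<le> L\<close> by (simp add: mult_left_mono)
    finally show ?thesis
      unfolding m_def using norm_triangle_ineq2[of "\<Phi> 0" "\<Phi> x"] by linarith
  qed
  define T where "T x = - r *\<^sub>R sgn (\<Phi> x)" for x
  have norm_T: "norm (T x) = r" if "x \<in> cball 0 r" for x
    using lower[OF that] \<open>0 < m\<close> \<open>0 < r\<close> by (auto simp: T_def norm_sgn)
  have contr: "dist (T x) (T y) \<le> (2 * L * r / m) * dist x y"
    if "x \<in> cball 0 r" "y \<in> cball 0 r" for x y
  proof -
    have "m * norm (sgn (\<Phi> x) - sgn (\<Phi> y)) \<le> norm (\<Phi> x) * norm (sgn (\<Phi> x) - sgn (\<Phi> y))"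
      using lower[OF that(1)] by (simp add: mult_right_mono)
    also have "\<dots> \<le> 2 * norm (\<Phi> x - \<Phi> y)"
      by (rule norm_mult_norm_sgn_diff_le)
    also have "\<dots> \<le> 2 * (L * dist x y)"
      using lipschitz_onD[OF lip that] by (simp add: dist_norm)
    finally have "norm (sgn (\<Phi> x) - sgn (\<Phi> y)) \<le> 2 * L / m * dist x y"
      using \<open>0 < m\<close> by (simp add: field_simps)
    then have "r * norm (sgn (\<Phi> x) - sgn (\<Phi> y)) \<le> r * (2 * L / m * dist x y)"
      by (rule mult_left_mono) (use \<open>0 < r\<close> in simp)
    moreover have "dist (T x) (T y) = r * norm (sgn (\<Phi> x) - sgn (\<Phi> y))"
      using \<open>0 < r\<close>
      by (simp add: T_def dist_norm norm_minus_commute flip: scaleR_diff_right)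
    ultimately show ?thesis by (simp add: ac_simps)
  qed
  have "\<exists>!x\<in>cball 0 r. T x = x"
  proof (rule Banach_fix[where c = "2 * L * r / m"])
    show "complete (cball (0::'a) r)"
      by (simp add: complete_eq_closed)
    show "cball (0::'a) r \<noteq> {}" "0 \<le> 2 * L * r / m" "2 * L * r / m < 1"
      using \<open>0 < r\<close> \<open>0 \<le> L\<close> \<open>0 < m\<close> m by simp_all
    show "T ` cball 0 r \<subseteq> cball 0 r"
      using norm_T by auto
  qed (use contr in blast)
  then obtain p where p: "p \<in> cball 0 r" "T p = p" by blast
  show thesis
  proof (rule that)
    show "norm p = r" using norm_T[OF p(1)] p(2) by simp
    have "\<Phi> p \<noteq> 0" using lower[OF p(1)] \<open>0 < m\<close> by auto
    have "- (norm (\<Phi> p) / r) *\<^sub>R T p = \<Phi> p"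
      using \<open>0 < r\<close> \<open>\<Phi> p \<noteq> 0\<close> by (simp add: T_def sgn_div_norm)
    then show "\<Phi> p = - (norm (\<Phi> p) / r) *\<^sub>R p"
      using p(2) by simp
    show "2 * L < norm (\<Phi> p) / r"
      using lower[OF p(1)] m \<open>0 < r\<close> by (simp add: field_simps)
  qed
qed

lemma ex1_strict_variational_solution:
  fixes \<Phi> :: "'a::{real_inner, complete_space} \<Rightarrow> 'a"
  assumes lip: "L-lipschitz_on (cball 0 r) \<Phi>" and "0 < r"
    and small: "3 * L * r < norm (\<Phi> 0)"
  shows "\<exists>!p. p \<in> sphere 0 r \<and>
           (\<forall>x \<in> cball 0 r - {p}. max (\<Phi> p \<bullet> (p - x)) (\<Phi> x \<bullet> (p - x)) < 0)"
    (is "\<exists>!p. ?P p")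
proof -
  obtain p c where p: "norm p = r" "\<Phi> p = - c *\<^sub>R p" "2 * L < c"
    using sphere_point_opposite_field[OF assms] .
  have "0 \<le> L" using lip by (rule lipschitz_on_nonneg)
  have "max (\<Phi> p \<bullet> (p - x)) (\<Phi> x \<bullet> (p - x)) < 0" if x: "x \<in> cball 0 r - {p}" for x
  proof -
    define d where "d = (norm (x - p))\<^sup>2"
    have "0 < d" using x by (simp add: d_def)
    have "c * (d / 2) \<le> c * (p \<bullet> (p - x))"
      using inner_diff_ge_on_cball[of x p] x p \<open>0 \<le> L\<close> by (simp add: d_def mult_left_mono)
    then have at_p: "\<Phi> p \<bullet> (p - x) \<le> - (c / 2) * d"
      using p(2) by simp
    have "(\<Phi> x - \<Phi> p) \<bullet> (p - x) \<le> norm (\<Phi> x - \<Phi> p) * norm (p - x)"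
      by (rule norm_cauchy_schwarz)
    also have "\<dots> \<le> (L * norm (x - p)) * norm (p - x)"
      using lipschitz_onD[OF lip, of x p] x p(1)
      by (intro mult_right_mono) (simp_all add: dist_norm)
    also have "\<dots> = L * d"
      by (simp add: d_def power2_eq_square norm_minus_commute)
    finally have "\<Phi> x \<bullet> (p - x) \<le> L * d + \<Phi> p \<bullet> (p - x)"
      by (simp add: inner_diff_left)
    moreover have "L * d < c / 2 * d" "0 < c / 2 * d"
      using p(3) \<open>0 < d\<close> \<open>0 \<le> L\<close> by simp_all
    ultimately show ?thesis using at_p by simp
  qed
  then have "?P p" using p(1) by simp
  moreover have "q = p" if "?P q" for q
  proof (rule ccontr)
    assume "q \<noteq> p"
    then have "\<Phi> p \<bullet> (p - q) < 0" "\<Phi> p \<bullet> (q - p) < 0"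
      using \<open>?P p\<close> \<open>?P q\<close> by auto
    then show False by (simp add: inner_diff_right)
  qed
  ultimately show ?thesis by blast
qed

theorem theorem2:
  fixes \<Phi> :: "'a::{real_inner, complete_space} \<Rightarrow> 'a"
    and \<Phi>' :: "'a \<Rightarrow> 'a \<Rightarrow>\<^sub>L 'a"
    and \<rho> \<gamma> \<theta> M r :: real
    and \<sigma> :: ereal
  assumes "\<rho> > 0"
    and "\<And>x. x \<in> cball 0 \<rho> \<Longrightarrow>
           (\<Phi> has_derivative blinfun_apply (\<Phi>' x)) (at x within cball 0 \<rho>)"
    and "continuous_on (cball 0 \<rho>) \<Phi>'"
    and "\<gamma> > 0"
    and "\<gamma>-lipschitz_on (cball 0 \<rho>) \<Phi>'"
    and "\<theta> = (SUP x\<in>cball 0 \<rho>. norm (\<Phi>' x))"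
    and "M = 2 * (\<theta> + \<rho> * \<gamma>)"
    and "\<sigma> = (INF y\<in>cball 0 \<rho>. SUP u\<in>sphere 0 1.
                ereal \<bar>\<Phi> 0 \<bullet> u - blinfun_apply (\<Phi>' 0) u \<bullet> y\<bar>)"
    and "\<sigma> > 0"
    and "0 < r"
    and "ereal r \<le> min (ereal \<rho>) (\<sigma> / ereal (2 * M))"
  shows "\<exists>!x'. x' \<in> sphere 0 r \<and>
           (\<forall>x \<in> cball 0 r - {x'}.
              max (\<Phi> x' \<bullet> (x' - x)) (\<Phi> x \<bullet> (x' - x)) < 0)"
proof -
  let ?B = "cball (0::'a) \<rho>"
  have bdd: "bdd_above ((\<lambda>x. norm (\<Phi>' x)) ` ?B)"
  proof (rule bdd_aboveI2)
    fix x assume x: "x \<in> ?B"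
    have "norm (\<Phi>' x - \<Phi>' 0) \<le> \<gamma> * norm x"
      using lipschitz_onD[OF assms(5) x, of 0] \<open>\<rho> > 0\<close> by (simp add: dist_norm)
    also have "\<dots> \<le> \<gamma> * \<rho>"
      using x \<open>\<gamma> > 0\<close> by simp
    finally show "norm (\<Phi>' x) \<le> norm (\<Phi>' 0) + \<gamma> * \<rho>"
      using norm_triangle_ineq2[of "\<Phi>' x" "\<Phi>' 0"] by linarith
  qed
  have \<theta>: "norm (\<Phi>' x) \<le> \<theta>" if "x \<in> ?B" for x
    unfolding assms(6) using that bdd by (rule cSUP_upper)
  have "0 \<le> \<theta>"
    using order_trans[OF norm_ge_zero \<theta>[of 0]] \<open>\<rho> > 0\<close> by simp
  have lip: "\<theta>-lipschitz_on ?B \<Phi>"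
  proof (rule lipschitz_onI)
    show "dist (\<Phi> x) (\<Phi> y) \<le> \<theta> * dist x y" if "x \<in> ?B" "y \<in> ?B" for x y
      unfolding dist_norm
      by (rule differentiable_bound[OF convex_cball assms(2) _ that])
        (use \<theta> in \<open>simp_all add: norm_blinfun.rep_eq\<close>)
  qed (rule \<open>0 \<le> \<theta>\<close>)
  have "0 < \<rho> * \<gamma>" using \<open>\<rho> > 0\<close> \<open>\<gamma> > 0\<close> by simp
  then have "0 < M" using \<open>0 \<le> \<theta>\<close> by (simp add: assms(7))
  \<comment> \<open>The value at \<open>y = 0\<close>; the estimate also holds when the unit sphere is empty.\<close>
  have "\<sigma> \<le> (SUP u\<in>sphere 0 1. ereal \<bar>\<Phi> 0 \<bullet> u - blinfun_apply (\<Phi>' 0) u \<bullet> 0\<bar>)"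
    unfolding assms(8) using \<open>\<rho> > 0\<close> by (intro INF_lower) simp
  also have "\<dots> \<le> ereal (norm (\<Phi> 0))"
  proof (rule SUP_least)
    fix u :: 'a assume "u \<in> sphere 0 1"
    then show "ereal \<bar>\<Phi> 0 \<bullet> u - blinfun_apply (\<Phi>' 0) u \<bullet> 0\<bar> \<le> ereal (norm (\<Phi> 0))"
      using Cauchy_Schwarz_ineq2[of "\<Phi> 0" u] by simp
  qed
  finally have "\<sigma> / ereal (2 * M) \<le> ereal (norm (\<Phi> 0)) / ereal (2 * M)"
    using \<open>0 < M\<close> by (intro ereal_divide_right_mono) simp_all
  moreover have "ereal r \<le> \<sigma> / ereal (2 * M)" and "r \<le> \<rho>"
    using assms(11) by simp_all
  ultimately have "r \<le> norm (\<Phi> 0) / (2 * M)"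
    using \<open>0 < M\<close> by (metis ereal_divide ereal_less_eq(3) less_numeral_extra(3) mult_eq_0_iff
        order_trans zero_neq_numeral)
  then have "2 * M * r \<le> norm (\<Phi> 0)"
    using \<open>0 < M\<close> by (simp add: field_simps)
  moreover have "3 * \<theta> * r < 2 * M * r"
    using \<open>0 < r\<close> \<open>0 \<le> \<theta>\<close> \<open>0 < \<rho> * \<gamma>\<close> by (simp add: assms(7))
  ultimately have "3 * \<theta> * r < norm (\<Phi> 0)" by linarith
  moreover have "\<theta>-lipschitz_on (cball 0 r) \<Phi>"
    using lip by (rule lipschitz_on_subset) (use \<open>r \<le> \<rho>\<close> in auto)
  ultimately show ?thesis
    using ex1_strict_variational_solution \<open>0 < r\<close> by blast
qed

end
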